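(* Let $R$ be a ring. If $R$ is $\Delta$-quasipolar, then $R$ is strongly $\Delta$-clean. Conversely, if $R$ is abelian and strongly $\Delta$-clean, then $R$ is $\Delta$-quasipolar.
   Context: All rings are associative and unital; $U(R)$ is the group of units of $R$. $\Delta(R)=\{r\in R \mid r+u\in U(R)\text{ for all }u\in U(R)\}$. For $a\in R$, $comm(a)=\{x\in R\mid ax=xa\}$ and $comm^2(a)=\{y\in R\mid xy=yx\text{ for all }x\in comm(a)\}$. An element $a\in R$ is $\Delta$-quasipolar if there exists $p^2=p\in comm^2(a)$ such that $a+p\in\Delta(R)$; $R$ is $\Delta$-quasipolar if every element of $R$ is $\Delta$-quasipolar. $R$ is strongly $\Delta$-clean if every $a\in R$ can be written as $a=e+d$ with $e^2=e\in R$, $d\in\Delta(R)$ and $ed=de$. $R$ is abelian if every idempotent of $R$ is central. *)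

theory Defs
  imports "HOL-Algebra.Ring"
begin

definition Delta :: "('a, 'm) ring_scheme \<Rightarrow> 'a set" where
  "Delta R = {r \<in> carrier R. \<forall>u \<in> Units R. r \<oplus>\<^bsub>R\<^esub> u \<in> Units R}"

definition comm :: "('a, 'm) ring_scheme \<Rightarrow> 'a \<Rightarrow> 'a set" where
  "comm R a = {x \<in> carrier R. a \<otimes>\<^bsub>R\<^esub> x = x \<otimes>\<^bsub>R\<^esub> a}"

definition comm2 :: "('a, 'm) ring_scheme \<Rightarrow> 'a \<Rightarrow> 'a set" where
  "comm2 R a = {y \<in> carrier R. \<forall>x \<in> comm R a. x \<otimes>\<^bsub>R\<^esub> y = y \<otimes>\<^bsub>R\<^esub> x}"

definition idempotents :: "('a, 'm) ring_scheme \<Rightarrow> 'a set" where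
  "idempotents R = {e \<in> carrier R. e \<otimes>\<^bsub>R\<^esub> e = e}"

definition Delta_quasipolar_element :: "('a, 'm) ring_scheme \<Rightarrow> 'a \<Rightarrow> bool" where
  "Delta_quasipolar_element R a \<longleftrightarrow>
     (\<exists>p \<in> idempotents R. p \<in> comm2 R a \<and> a \<oplus>\<^bsub>R\<^esub> p \<in> Delta R)"

definition Delta_quasipolar :: "('a, 'm) ring_scheme \<Rightarrow> bool" where
  "Delta_quasipolar R \<longleftrightarrow> (\<forall>a \<in> carrier R. Delta_quasipolar_element R a)"

definition strongly_Delta_clean :: "('a, 'm) ring_scheme \<Rightarrow> bool" where
  "strongly_Delta_clean R \<longleftrightarrow>
     (\<forall>a \<in> carrier R. \<exists>e \<in> idempotents R. \<exists>d \<in> Delta R.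
        a = e \<oplus>\<^bsub>R\<^esub> d \<and> e \<otimes>\<^bsub>R\<^esub> d = d \<otimes>\<^bsub>R\<^esub> e)"

(* "Abelian" in the ring-theoretic sense (idempotents are central), unrelated to the
   locales abelian_group and abelian_monoid of HOL-Algebra. *)
definition idempotent_abelian :: "('a, 'm) ring_scheme \<Rightarrow> bool" where
  "idempotent_abelian R \<longleftrightarrow>
     (\<forall>e \<in> idempotents R. \<forall>x \<in> carrier R. e \<otimes>\<^bsub>R\<^esub> x = x \<otimes>\<^bsub>R\<^esub> e)"

end

theory Submission
  imports Defs
begin

text \<open>Both directions apply the hypothesis to \<open>\<ominus> a\<close>: since \<open>Delta R\<close> is closed under
  negation, \<open>\<ominus> a \<oplus> p \<in> Delta R\<close> says the same as \<open>a \<ominus> p \<in> Delta R\<close>.\<close>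

context ring
begin

lemma a_inv_in_Units:
  assumes "u \<in> Units R"
  shows "\<ominus> u \<in> Units R"
proof -
  have "\<ominus> u \<otimes> \<ominus> (inv u) = \<one>" "\<ominus> (inv u) \<otimes> \<ominus> u = \<one>"
    using assms by (simp_all add: Units_closed l_minus r_minus)
  moreover have "\<ominus> u \<in> carrier R" "\<ominus> (inv u) \<in> carrier R"
    using assms by (simp_all add: Units_closed)
  ultimately show ?thesis
    unfolding Units_def by blast
qed

text \<open>Negation permutes the units, and \<open>\<ominus> r \<oplus> u\<close> is the negative
  of \<open>r \<oplus> \<ominus> u\<close>, which is a unit by the defining property of
  \<open>r\<close> at the unit \<open>\<ominus> u\<close>.\<close>

lemma a_inv_in_Delta:
  assumes "r \<in> Delta R"
  shows "\<ominus> r \<in> Delta R"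
proof -
  have r: "r \<in> carrier R"
    using assms by (simp add: Delta_def)
  have "\<ominus> r \<oplus> u \<in> Units R" if u: "u \<in> Units R" for u
  proof -
    have "r \<oplus> \<ominus> u \<in> Units R"
      using assms a_inv_in_Units[OF u] by (simp add: Delta_def)
    from a_inv_in_Units[OF this] show ?thesis
      using r u by (simp add: Units_closed minus_add)
  qed
  then show ?thesis
    using r by (simp add: Delta_def)
qed

text \<open>The idempotent \<open>p\<close> that quasipolarity supplies for
  \<open>\<ominus> a\<close> serves as the clean idempotent of \<open>a\<close>, with
  \<open>d = a \<ominus> p\<close>.\<close>

lemma Delta_quasipolar_imp_strongly_Delta_clean:
  assumes "Delta_quasipolar R"
  shows "strongly_Delta_clean R"
  unfolding strongly_Delta_clean_def
proof
  fix a assume a: "a \<in> carrier R"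
  then obtain p where p: "p \<in> idempotents R" "p \<in> comm2 R (\<ominus> a)" "\<ominus> a \<oplus> p \<in> Delta R"
    using assms by (auto simp: Delta_quasipolar_def Delta_quasipolar_element_def)
  have pc: "p \<in> carrier R"
    using p(1) by (simp add: idempotents_def)
  \<comment> \<open>The double commutant enters here: \<open>p\<close> commutes with whatever
    commutes with \<open>\<ominus> a\<close>, in particular with \<open>a\<close>, hence with
    \<open>a \<ominus> p\<close>.\<close>
  have "a \<in> comm R (\<ominus> a)"
    using a by (simp add: comm_def l_minus r_minus)
  then have "p \<otimes> a = a \<otimes> p"
    using p(2) by (simp add: comm2_def)
  then have "p \<otimes> (a \<ominus> p) = (a \<ominus> p) \<otimes> p"
    using a pc by (simp add: minus_eq l_distr r_distr l_minus r_minus)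
  moreover have "a \<ominus> p \<in> Delta R"
    using a_inv_in_Delta[OF p(3)] a pc by (simp add: minus_add minus_eq)
  moreover have "a = p \<oplus> (a \<ominus> p)"
    using a pc by (simp add: minus_eq a_lcomm r_neg)
  ultimately show "\<exists>e\<in>idempotents R. \<exists>d\<in>Delta R. a = e \<oplus> d \<and> e \<otimes> d = d \<otimes> e"
    using p(1) by blast
qed

text \<open>A decomposition \<open>\<ominus> a = e \<oplus> d\<close> turns into
  \<open>a \<oplus> e = \<ominus> d\<close>, so \<open>e\<close> is the idempotent wanted for
  \<open>a\<close>. A central \<open>e\<close> lies in the double commutant of every
  element.\<close>

lemma strongly_Delta_clean_imp_Delta_quasipolar:
  assumes "idempotent_abelian R" "strongly_Delta_clean R"
  shows "Delta_quasipolar R"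
  unfolding Delta_quasipolar_def Delta_quasipolar_element_def
proof
  fix a assume a: "a \<in> carrier R"
  then obtain e d where e: "e \<in> idempotents R" and d: "d \<in> Delta R" and eq: "\<ominus> a = e \<oplus> d"
    using assms(2) unfolding strongly_Delta_clean_def by (meson a_inv_closed)
  have ec: "e \<in> carrier R" and dc: "d \<in> carrier R"
    using e d by (simp_all add: idempotents_def Delta_def)
  \<comment> \<open>The summands are swapped so that expanding the negative leaves
    \<open>\<ominus> e\<close> on the right, where adding \<open>e\<close> cancels it.\<close>
  have "a = \<ominus> (d \<oplus> e)"
    using a ec dc eq minus_minus a_comm by metis
  then have "a \<oplus> e = \<ominus> d"
    using ec dc by (simp add: minus_add a_assoc l_neg)
  then have "a \<oplus> e \<in> Delta R"
    using a_inv_in_Delta[OF d] by simp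
  moreover have "e \<in> comm2 R a"
    using assms(1) e ec by (simp add: idempotent_abelian_def comm2_def comm_def)
  ultimately show "\<exists>p\<in>idempotents R. p \<in> comm2 R a \<and> a \<oplus> p \<in> Delta R"
    using e by blast
qed

end

theorem theorem2p6:
  fixes R :: "('a, 'm) ring_scheme"
  assumes "ring R"
  shows "(Delta_quasipolar R \<longrightarrow> strongly_Delta_clean R) \<and>
         (idempotent_abelian R \<and> strongly_Delta_clean R \<longrightarrow> Delta_quasipolar R)"
  using ring.Delta_quasipolar_imp_strongly_Delta_clean[OF assms]
    ring.strongly_Delta_clean_imp_Delta_quasipolar[OF assms] by blast

end
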